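(* Let $A_1, \ldots, A_n$ be events ($n \geq 1$) in a probability space with probability measure $P$. Then both of the following are valid upper bounds on the probability of the union: $$P\Big(\bigcup_{i=1}^{n} A_i\Big) \leq \sum_{i=1}^n P(A_i) - (n-1)\,P\Big(\bigcap_{i=1}^n A_i\Big)$$ and $$P\Big(\bigcup_{i=1}^{n} A_i\Big) \leq \sum_{i=1}^n P(A_i) - (n-1)\Big[\sum_{i=1}^n P(A_i) - (n-1)\Big]_+ .$$ Moreover, each of these bounds is equal to or tighter than Boole's bound $\sum_{i=1}^n P(A_i)$, i.e. $$\sum_{i=1}^n P(A_i) - (n-1)\,P\Big(\bigcap_{i=1}^n A_i\Big) \leq \sum_{i=1}^n P(A_i)$$ and $$\sum_{i=1}^n P(A_i) - (n-1)\Big[\sum_{i=1}^n P(A_i) - (n-1)\Big]_+ \leq \sum_{i=1}^n P(A_i).$$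
   Context: For a real number $t$, $[t]_+$ denotes $\max(0,t)$. Boole's inequality is the statement $P\big(\bigcup_{i=1}^n A_i\big) \leq \sum_{i=1}^n P(A_i)$. *)

theory Defs
  imports "HOL-Probability.Probability"
begin

end

theory Submission
  imports Defs
begin

text \<open>
  Every point of the intersection lies in all \<open>n\<close> events, so Boole's sum counts it \<open>n - 1\<close> times
  too often; this excess can be subtracted. The second bound follows from the first by
  Bonferroni's lower bound for the probability of the intersection.
\<close>

text \<open>Induction on the index set: inclusion-exclusion for a new event and the old union yields
  one more copy of the intersection to subtract, and the copies from the induction hypothesis can be
  shrunk to the new intersection.\<close>

lemma (in finite_measure) measure_UN_le_sum_minus_INT:
  assumes "finite I" "I \<noteq> {}" "\<And>i. i \<in> I \<Longrightarrow> A i \<in> sets M"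
  shows "measure M (\<Union>i\<in>I. A i)
           \<le> (\<Sum>i\<in>I. measure M (A i)) - (real (card I) - 1) * measure M (\<Inter>i\<in>I. A i)"
  using assms
proof (induction I rule: finite_ne_induct)
  case (singleton i)
  then show ?case by simp
next
  case (insert j I)
  let ?U = "\<Union>i\<in>I. A i" and ?N = "\<Inter>i\<in>I. A i"
  have sets: "A j \<in> sets M" "?U \<in> sets M" "?N \<in> sets M"
    using insert.hyps insert.prems by (auto intro!: sets.finite_INT)
  have "measure M (A j \<union> ?U) = measure M (A j) + measure M ?U - measure M (A j \<inter> ?U)"
    using sets by (intro measure_Un3) (auto simp: fmeasurable_eq_sets)
  \<comment> \<open>The additional copy: \<open>?N\<close> lies inside \<open>?U\<close> because
    \<open>I\<close> is nonempty.\<close>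
  moreover have "measure M (A j \<inter> ?N) \<le> measure M (A j \<inter> ?U)"
    using sets insert.hyps by (intro finite_measure_mono) auto
  \<comment> \<open>The old copies: nonemptiness of \<open>I\<close> also makes the factor
    nonnegative.\<close>
  moreover have "(real (card I) - 1) * measure M (A j \<inter> ?N) \<le> (real (card I) - 1) * measure M ?N"
    using sets insert.hyps
    by (intro mult_left_mono finite_measure_mono) (auto simp: Suc_le_eq card_gt_0_iff)
  moreover have "measure M ?U
      \<le> (\<Sum>i\<in>I. measure M (A i)) - (real (card I) - 1) * measure M ?N"
    using insert by auto
  ultimately show ?case
    using insert.hyps by (simp add: algebra_simps)
qed

text \<open>Bonferroni's bound. Each event after the first costs at most 1, since the union in
  two-set inclusion-exclusion has probability at most 1.\<close>

lemma (in prob_space) prob_INT_ge_sum_minus: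
  assumes "finite I" "I \<noteq> {}" "\<And>i. i \<in> I \<Longrightarrow> A i \<in> events"
  shows "(\<Sum>i\<in>I. prob (A i)) - (real (card I) - 1) \<le> prob (\<Inter>i\<in>I. A i)"
  using assms
proof (induction I rule: finite_ne_induct)
  case (singleton i)
  then show ?case by simp
next
  case (insert j I)
  let ?N = "\<Inter>i\<in>I. A i"
  have "A j \<in> events" "?N \<in> events"
    using insert.hyps insert.prems by (auto intro!: sets.finite_INT)
  then have "prob (A j \<union> ?N) = prob (A j) + prob ?N - prob (A j \<inter> ?N)"
    by (intro measure_Un3) (auto simp: fmeasurable_eq_sets)
  moreover have "prob (A j \<union> ?N) \<le> 1"
    by (rule prob_le_1)
  moreover have "(\<Sum>i\<in>I. prob (A i)) - (real (card I) - 1) \<le> prob ?N"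
    using insert by auto
  ultimately show ?case
    using insert.hyps by simp
qed

theorem proposition1:
  fixes M :: "'a measure" and A :: "nat \<Rightarrow> 'a set" and n :: nat
  assumes "prob_space M"
    and "n \<ge> 1"
    and "\<And>i. i \<in> {1..n} \<Longrightarrow> A i \<in> sets M"
  shows "measure M (\<Union>i\<in>{1..n}. A i)
           \<le> (\<Sum>i=1..n. measure M (A i)) - (real n - 1) * measure M (\<Inter>i\<in>{1..n}. A i)
    \<and> measure M (\<Union>i\<in>{1..n}. A i)
           \<le> (\<Sum>i=1..n. measure M (A i))
              - (real n - 1) * max 0 ((\<Sum>i=1..n. measure M (A i)) - (real n - 1))
    \<and> (\<Sum>i=1..n. measure M (A i)) - (real n - 1) * measure M (\<Inter>i\<in>{1..n}. A i)
           \<le> (\<Sum>i=1..n. measure M (A i))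
    \<and> (\<Sum>i=1..n. measure M (A i))
              - (real n - 1) * max 0 ((\<Sum>i=1..n. measure M (A i)) - (real n - 1))
           \<le> (\<Sum>i=1..n. measure M (A i))"
proof -
  interpret prob_space M by fact
  have I: "finite {1..n}" "{1..n} \<noteq> {}"
    using assms(2) by auto
  let ?S = "\<Sum>i=1..n. measure M (A i)" and ?N = "measure M (\<Inter>i\<in>{1..n}. A i)"
  have union: "measure M (\<Union>i\<in>{1..n}. A i) \<le> ?S - (real n - 1) * ?N"
    using measure_UN_le_sum_minus_INT[OF I assms(3)] by simp
  \<comment> \<open>Bonferroni's bound may be negative; truncating it at 0 keeps it valid because
    \<open>?N\<close> is nonnegative.\<close>
  have "max 0 (?S - (real n - 1)) \<le> ?N"
    using prob_INT_ge_sum_minus[OF I assms(3)] by simp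
  then have "(real n - 1) * max 0 (?S - (real n - 1)) \<le> (real n - 1) * ?N"
    using assms(2) by (intro mult_left_mono) auto
  \<comment> \<open>Both corrections are nonnegative, which gives the two comparisons with Boole's
    bound.\<close>
  moreover have "0 \<le> (real n - 1) * ?N" "0 \<le> (real n - 1) * max 0 (?S - (real n - 1))"
    using assms(2) by (auto intro!: mult_nonneg_nonneg)
  ultimately show ?thesis
    using union by linarith
qed

end
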